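(* Let $N\ge 1$ and $m\ge 0$ be integers, let $M_0,\dots,M_m\in\mathbb{C}^{N\times N}$, and let $S(t)=\sum_{j=0}^m M_j t^j$. (1) If $S$ is of type $(s,u,\ell)$ with $u\ge 1$, then $\limsup_{n\to\infty}\kappa(T_n(S))=\infty$. (2) If $S$ is of type $(0,u,\ell)$, then $\kappa(T_n(S))$ increases at most polynomially, that is, there is a finite number $\nu$ such that $\kappa(T_n(S))=O(n^\nu)$ as $n\to\infty$. (3) If $S$ is of type $(s,0,\ell)$ with $s\ge 1$, then $\kappa(T_n(S))$ increases exponentially.
   Context: The matrix polynomial $S$ is said to be of type $(s,u,\ell)$ if the scalar polynomial $\det S$ has $s$ zeros of modulus smaller than $1$, $u$ zeros of modulus equal to $1$, and $\ell$ zeros of modulus larger than $1$, where zeros are counted with their multiplicity. $T_n(S)=(M_{i-j})_{i,j=0}^{n-1}\in\mathbb{C}^{nN\times nN}$, with $M_j:=0$ for $j<0$ or $j>m$, is the block lower triangular banded block Toeplitz matrix with symbol $S$. The condition number is $\kappa(T_n(S))=\|T_n(S)\|\,\|T_n(S)^{-1}\|$, where $\|\cdot\|$ is the spectral norm, and $\kappa(T_n(S))=\infty$ if $T_n(S)$ is not invertible. *)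

theory Defs
  imports
    "HOL-Analysis.L2_Norm"
    "HOL-Library.Extended_Real"
    "HOL-Library.Liminf_Limsup"
    "Jordan_Normal_Form.Determinant"
    "Jordan_Normal_Form.Gauss_Jordan_Elimination"
begin

definition matrix_poly :: "nat \<Rightarrow> nat \<Rightarrow> (nat \<Rightarrow> complex mat) \<Rightarrow> complex poly mat" where
  "matrix_poly N m M = mat N N (\<lambda>(i, j). \<Sum>k\<le>m. monom (M k $$ (i, j)) k)"

text \<open>A type presupposes finitely many zeros, so the determinant must not vanish identically
  (\<^const>\<open>proots\<close> of the zero polynomial is the empty multiset). \<^const>\<open>proots\<close> lists every
  zero as often as its multiplicity.\<close>

definition of_type :: "complex poly mat \<Rightarrow> nat \<Rightarrow> nat \<Rightarrow> nat \<Rightarrow> bool" where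
  "of_type S s u l \<longleftrightarrow>
     det S \<noteq> 0 \<and>
     size {#z \<in># proots (det S). cmod z < 1#} = s \<and>
     size {#z \<in># proots (det S). cmod z = 1#} = u \<and>
     size {#z \<in># proots (det S). cmod z > 1#} = l"

definition coeff_block :: "nat \<Rightarrow> nat \<Rightarrow> (nat \<Rightarrow> complex mat) \<Rightarrow> int \<Rightarrow> complex mat" where
  "coeff_block N m M k = (if 0 \<le> k \<and> k \<le> int m then M (nat k) else 0\<^sub>m N N)"

text \<open>Scalar row \<open>r\<close> of an \<open>nN \<times> nN\<close> matrix lies in block row \<open>r div N\<close>, at position
  \<open>r mod N\<close> inside that block; likewise for columns.\<close>

definition block_toeplitz :: "nat \<Rightarrow> nat \<Rightarrow> (nat \<Rightarrow> complex mat) \<Rightarrow> nat \<Rightarrow> complex mat" where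
  "block_toeplitz N m M n =
     mat (n * N) (n * N) (\<lambda>(r, c).
       coeff_block N m M (int (r div N) - int (c div N)) $$ (r mod N, c mod N))"

definition euclid_norm :: "complex vec \<Rightarrow> real" where
  "euclid_norm v = L2_set (\<lambda>i. cmod (v $ i)) {..<dim_vec v}"

definition spectral_norm :: "complex mat \<Rightarrow> real" where
  "spectral_norm A =
     (SUP v \<in> {v \<in> carrier_vec (dim_col A). euclid_norm v \<le> 1}. euclid_norm (A *\<^sub>v v))"

text \<open>On square matrices, \<^const>\<open>mat_inverse\<close> returns \<^const>\<open>None\<close> exactly for the singular ones.\<close>

definition cond_number :: "complex mat \<Rightarrow> ereal" where
  "cond_number A =
     (case mat_inverse A of
        None \<Rightarrow> \<infinity>
      | Some B \<Rightarrow> ereal (spectral_norm A * spectral_norm B))"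

text \<open>The two growth notions are stated for extended real sequences: an infinite value violates the
  polynomial bound, but is compatible with exponential increase. The latter is the usual lower
  bound; no upper bound can be part of it, because all condition numbers are infinite when the
  constant coefficient of the symbol is singular.\<close>

definition polynomially_bounded :: "(nat \<Rightarrow> ereal) \<Rightarrow> bool" where
  "polynomially_bounded f \<longleftrightarrow>
     (\<exists>\<nu>::real. \<exists>C::real. \<forall>\<^sub>F n in sequentially. f n \<le> ereal (C * real n powr \<nu>))"

definition increases_exponentially :: "(nat \<Rightarrow> ereal) \<Rightarrow> bool" where
  "increases_exponentially f \<longleftrightarrow>
     (\<exists>C>0. \<exists>\<gamma>>0. \<forall>n\<ge>1. ereal (C * exp (\<gamma> * real n)) \<le> f n)"

end

theory Submission
  imports Defs
    "HOL-Computational_Algebra.Polynomial_FPS"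
    "HOL-Computational_Algebra.Fundamental_Theorem_Algebra"
begin

text \<open>A vector that $T_n(S)$ shrinks by a large factor, compared with its norm, makes the condition
  number large, and a zero \<open>z\<close> of $\det S$ in the closed unit disc provides one. If \<open>w\<close> is a
  nonzero vector in the kernel of $S(z)$, let \<open>x\<close> have the blocks $z^{n-1} w, \ldots, z w, w$. Block \<open>i\<close> of
  $T_n(S) x$ is $z^{n-1-i} \sum_{k \le i} z^k M_k w$, where the sum is $S(z) w = 0$ as soon as \<open>i\<close>
  reaches the degree of \<open>S\<close>. So only a fixed number of blocks survive, all of size $O(|z|^n)$, while
  the norm of \<open>x\<close> is that of \<open>w\<close> times $(\sum_{j<n} |z|^{2j})^{1/2}$. If $M_0$ is invertible, the
  norm of $T_n(S)$ stays away from \<open>0\<close>, and if it is not, then $T_n(S)$ is singular; so the condition number is at least a constant times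
  $(\sum_{j<n} |z|^{2j})^{1/2} / |z|^n$ (lemma \<open>cond_number_toeplitz_section_lower_bound\<close>). This is
  of order $\sqrt n$ for $|z| = 1$ and grows exponentially for $0 < |z| < 1$. For $z = 0$ the vector
  \<open>x\<close> lies in the kernel of $T_n(S)$, and the condition number is infinite.

  If all zeros have modulus at least \<open>1\<close>, then \<open>S\<close> is invertible over the ring of formal power series.
  Sending a matrix of power series to its block Toeplitz matrix of order \<open>n\<close> is multiplicative
  (\<open>toeplitz_section_mult\<close>), because the blocks of a product of lower triangular block Toeplitz
  matrices are Cauchy products. Hence $T_n(S)^{-1}$ is built from the coefficients of
  $S^{-1} = (\det S)^{-1} \, \mathrm{adj}\, S$. Splitting $\det S$ into linear factors,
  $(\det S)^{-1}$ is a constant times a product of series $(t - z)^{-1}$ with $|z| \ge 1$. Each of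
  these has bounded coefficients, and the product has polynomially bounded ones
  (\<open>poly_growth_inverse_fps_of_poly\<close>).\<close>

section \<open>Spectral norm and condition number\<close>

text \<open>A crude upper bound for the spectral norm that is easy to compute. Since the order of the
  matrices is linear in \<open>n\<close>, it loses only a power of \<open>n\<close>.\<close>

definition entry_sum :: "complex mat \<Rightarrow> real" where
  "entry_sum A = (\<Sum>i<dim_row A. \<Sum>j<dim_col A. cmod (A $$ (i, j)))"

lemma euclid_norm_nonneg: "0 \<le> euclid_norm v"
  by (simp add: euclid_norm_def)

lemma component_le_euclid_norm: "i < dim_vec v \<Longrightarrow> cmod (v $ i) \<le> euclid_norm v"
  unfolding euclid_norm_def
  using member_le_L2_set[of "{..<dim_vec v}" i "\<lambda>i. cmod (v $ i)"] by simp

lemma euclid_norm_le_sum: "euclid_norm v \<le> (\<Sum>i<dim_vec v. cmod (v $ i))"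
  unfolding euclid_norm_def by (rule L2_set_le_sum) simp

lemma euclid_norm_smult: "euclid_norm (c \<cdot>\<^sub>v v) = cmod c * euclid_norm v"
proof -
  have "euclid_norm (c \<cdot>\<^sub>v v) = L2_set (\<lambda>i. cmod c * cmod (v $ i)) {..<dim_vec v}"
    unfolding euclid_norm_def by (rule L2_set_cong) (auto simp: norm_mult)
  then show ?thesis by (simp add: euclid_norm_def L2_set_right_distrib)
qed

lemma euclid_norm_zero [simp]: "euclid_norm (0\<^sub>v n) = 0"
  by (simp add: euclid_norm_def L2_set_eq_0_iff)

lemma euclid_norm_eq_0:
  assumes "euclid_norm v = 0" "v \<in> carrier_vec n" shows "v = 0\<^sub>v n"
  using assms by (intro eq_vecI) (auto simp: euclid_norm_def L2_set_eq_0_iff)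

lemma euclid_norm_mult_mat_vec_le:
  assumes "v \<in> carrier_vec (dim_col A)"
  shows "euclid_norm (A *\<^sub>v v) \<le> entry_sum A * euclid_norm v"
proof -
  have "euclid_norm (A *\<^sub>v v) \<le> (\<Sum>i<dim_row A. cmod ((A *\<^sub>v v) $ i))"
    using euclid_norm_le_sum[of "A *\<^sub>v v"] by simp
  also have "\<dots> \<le> (\<Sum>i<dim_row A. \<Sum>j<dim_col A. cmod (A $$ (i, j)) * euclid_norm v)"
  proof (rule sum_mono)
    fix i assume i: "i \<in> {..<dim_row A}"
    have "cmod ((A *\<^sub>v v) $ i) = cmod (\<Sum>j<dim_col A. A $$ (i, j) * v $ j)"
      using i assms by (simp add: scalar_prod_def lessThan_atLeast0)
    also have "\<dots> \<le> (\<Sum>j<dim_col A. cmod (A $$ (i, j)) * euclid_norm v)"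
      using assms by (intro sum_norm_le)
        (auto simp: norm_mult intro!: mult_left_mono component_le_euclid_norm)
    finally show "cmod ((A *\<^sub>v v) $ i) \<le> \<dots>" .
  qed
  finally show ?thesis by (simp add: entry_sum_def sum_distrib_right)
qed

lemma entry_sum_nonneg: "0 \<le> entry_sum A"
  unfolding entry_sum_def by (intro sum_nonneg) auto

lemma unit_ball_image_le_entry_sum:
  assumes "v \<in> carrier_vec (dim_col A)" "euclid_norm v \<le> 1"
  shows "euclid_norm (A *\<^sub>v v) \<le> entry_sum A"
  using euclid_norm_mult_mat_vec_le[OF assms(1)]
    mult_left_mono[OF assms(2) entry_sum_nonneg[of A]] by simp

lemma spectral_norm_le_entry_sum: "spectral_norm A \<le> entry_sum A"
  unfolding spectral_norm_def
proof (rule cSUP_least)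
  have "0\<^sub>v (dim_col A) \<in> {v \<in> carrier_vec (dim_col A). euclid_norm v \<le> 1}" by simp
  then show "{v \<in> carrier_vec (dim_col A). euclid_norm v \<le> 1} \<noteq> {}" by blast
qed (auto intro: unit_ball_image_le_entry_sum)

text \<open>The supremum that defines the spectral norm carries information only because it ranges over
  a bounded set; this is where finiteness of the matrix enters.\<close>

lemma unit_ball_image_le_spectral_norm:
  assumes "v \<in> carrier_vec (dim_col A)" "euclid_norm v \<le> 1"
  shows "euclid_norm (A *\<^sub>v v) \<le> spectral_norm A"
  unfolding spectral_norm_def using assms
  by (intro cSUP_upper bdd_aboveI2[where M = "entry_sum A"])
    (auto intro: unit_ball_image_le_entry_sum)

lemma spectral_norm_nonneg: "0 \<le> spectral_norm A"
  using unit_ball_image_le_spectral_norm[of "0\<^sub>v (dim_col A)" A]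
    order_trans[OF euclid_norm_nonneg] by simp

lemma euclid_norm_mult_mat_vec_le_spectral_norm:
  assumes v: "v \<in> carrier_vec (dim_col A)"
  shows "euclid_norm (A *\<^sub>v v) \<le> spectral_norm A * euclid_norm v"
proof (cases "euclid_norm v = 0")
  case True
  then show ?thesis using euclid_norm_mult_mat_vec_le[OF v] by simp
next
  case False
  then have pos: "euclid_norm v > 0" using euclid_norm_nonneg[of v] by simp
  define c where "c = complex_of_real (inverse (euclid_norm v))"
  have c: "cmod c = inverse (euclid_norm v)" using pos unfolding c_def norm_of_real by simp
  have "A *\<^sub>v (c \<cdot>\<^sub>v v) = c \<cdot>\<^sub>v (A *\<^sub>v v)"
    by (rule mult_mat_vec[of A "dim_row A" "dim_col A"]) (use v in auto)
  moreover have "euclid_norm (A *\<^sub>v (c \<cdot>\<^sub>v v)) \<le> spectral_norm A"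
    by (rule unit_ball_image_le_spectral_norm) (use v pos c in \<open>auto simp: euclid_norm_smult\<close>)
  ultimately have "inverse (euclid_norm v) * euclid_norm (A *\<^sub>v v) \<le> spectral_norm A"
    by (simp add: euclid_norm_smult c)
  then show ?thesis using pos by (simp add: field_simps)
qed

lemma entry_le_spectral_norm:
  assumes "i < dim_row A" "j < dim_col A"
  shows "cmod (A $$ (i, j)) \<le> spectral_norm A"
proof -
  have e: "unit_vec (dim_col A) j \<in> carrier_vec (dim_col A)" by simp
  have "(\<Sum>i<dim_col A. (cmod (unit_vec (dim_col A) j $ i))\<^sup>2) = (\<Sum>i<dim_col A. if i = j then 1 else 0)"
    using assms by (intro sum.cong) (auto simp: unit_vec_def)
  then have "euclid_norm (unit_vec (dim_col A) j) \<le> 1"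
    using assms by (simp add: euclid_norm_def L2_set_def)
  then have "euclid_norm (A *\<^sub>v unit_vec (dim_col A) j) \<le> spectral_norm A"
    by (rule unit_ball_image_le_spectral_norm[OF e])
  moreover have "(A *\<^sub>v unit_vec (dim_col A) j) $ i = A $$ (i, j)"
    using assms by simp
  ultimately show ?thesis
    using component_le_euclid_norm[of i "A *\<^sub>v unit_vec (dim_col A) j"] assms by simp
qed

lemma cond_number_singular:
  assumes A: "A \<in> carrier_mat n n" and x: "x \<in> carrier_vec n" "x \<noteq> 0\<^sub>v n"
    and Ax: "A *\<^sub>v x = 0\<^sub>v n"
  shows "cond_number A = \<infinity>"
proof (cases "mat_inverse A")
  case (Some B)
  from mat_inverse(2)[OF A this] have B: "B * A = 1\<^sub>m n" "B \<in> carrier_mat n n" by auto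
  have "x = (B * A) *\<^sub>v x" using B x by simp
  also have "\<dots> = B *\<^sub>v (A *\<^sub>v x)" by (rule assoc_mult_mat_vec[OF B(2) A x(1)])
  also have "\<dots> = 0\<^sub>v n" using B Ax by auto
  finally show ?thesis using x by simp
qed (simp add: cond_number_def)

text \<open>A vector that \<open>A\<close> shrinks to length \<open>D\<close> is stretched back by the inverse, so
  \<open>euclid_norm x / D\<close> bounds the norm of the inverse from below. A singular \<open>A\<close> causes no harm, as
  its condition number is infinite.\<close>

lemma cond_number_lower_bound:
  assumes A: "A \<in> carrier_mat n n" and x: "x \<in> carrier_vec n" "x \<noteq> 0\<^sub>v n"
    and c: "0 \<le> c" "c \<le> spectral_norm A" and D: "0 < D" "euclid_norm (A *\<^sub>v x) \<le> D"
  shows "ereal (c * euclid_norm x / D) \<le> cond_number A"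
proof (cases "mat_inverse A")
  case (Some B)
  from mat_inverse(2)[OF A this] have B: "B * A = 1\<^sub>m n" "B \<in> carrier_mat n n" by auto
  have "x = (B * A) *\<^sub>v x" using B x by simp
  also have "\<dots> = B *\<^sub>v (A *\<^sub>v x)" by (rule assoc_mult_mat_vec[OF B(2) A x(1)])
  finally have "euclid_norm x = euclid_norm (B *\<^sub>v (A *\<^sub>v x))" by simp
  also have "\<dots> \<le> spectral_norm B * euclid_norm (A *\<^sub>v x)"
    by (rule euclid_norm_mult_mat_vec_le_spectral_norm)
      (metis A B(2) carrier_matD(2) mult_mat_vec_carrier x(1))
  also have "\<dots> \<le> spectral_norm B * D" by (intro mult_left_mono D spectral_norm_nonneg)
  finally have "euclid_norm x / D \<le> spectral_norm B" using D by (simp add: field_simps)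
  then have "c * (euclid_norm x / D) \<le> spectral_norm A * spectral_norm B"
    by (intro mult_mono c) (auto simp: spectral_norm_nonneg euclid_norm_nonneg D less_imp_le)
  then show ?thesis by (simp add: cond_number_def Some)
qed (simp add: cond_number_def)

lemma cond_number_le:
  assumes A: "A \<in> carrier_mat n n" and B: "B \<in> carrier_mat n n"
    and AB: "A * B = 1\<^sub>m n" and BA: "B * A = 1\<^sub>m n"
  shows "cond_number A \<le> ereal (entry_sum A * entry_sum B)"
proof (cases "mat_inverse A")
  case None
  have "A \<in> Units (ring_mat TYPE(complex) n ())"
    using A B AB BA by (auto simp: Units_def ring_mat_def)
  with mat_inverse(1)[OF A None, of "()"] show ?thesis by blast
next
  case (Some C)
  from mat_inverse(2)[OF A this] have C: "C * A = 1\<^sub>m n" "C \<in> carrier_mat n n" by auto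
  have "C = C * (A * B)" using AB C by simp
  also have "\<dots> = (C * A) * B" by (rule assoc_mult_mat[symmetric, OF C(2) A B])
  also have "\<dots> = B" using C B by simp
  finally show ?thesis
    by (simp add: cond_number_def Some spectral_norm_le_entry_sum spectral_norm_nonneg
        entry_sum_nonneg mult_mono)
qed

section \<open>Block Toeplitz sections of power series matrices\<close>

text \<open>The leading \<open>n \<times> n\<close> blocks of the infinite lower triangular block Toeplitz matrix with symbol
  \<open>F\<close>. Symbols are power series, not polynomials, so that inverses of block Toeplitz matrices
  have the same form.\<close>

definition toeplitz_section :: "nat \<Rightarrow> complex fps mat \<Rightarrow> nat \<Rightarrow> complex mat" where
  "toeplitz_section N F n = mat (n * N) (n * N) (\<lambda>(r, c).
     if c div N \<le> r div N then fps_nth (F $$ (r mod N, c mod N)) (r div N - c div N) else 0)"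

lemma toeplitz_section_carrier [simp]: "toeplitz_section N F n \<in> carrier_mat (n * N) (n * N)"
  by (simp add: toeplitz_section_def)

lemma dim_toeplitz_section [simp]:
  "dim_row (toeplitz_section N F n) = n * N" "dim_col (toeplitz_section N F n) = n * N"
  by (simp_all add: toeplitz_section_def)

lemma block_index_less:
  fixes i a n N :: nat
  assumes "i < n" "a < N" shows "i * N + a < n * N"
proof -
  have "i * N + a < Suc i * N" using assms by simp
  also have "\<dots> \<le> n * N" using assms by (intro mult_le_mono1) simp
  finally show ?thesis .
qed

lemma block_index_cases:
  fixes r n N :: nat
  assumes "r < n * N"
  obtains i a where "i < n" "a < N" "r = i * N + a"
proof
  have "N > 0" using assms by (cases N) auto
  then show "r mod N < N" by simp
  show "r div N < n" using assms by (simp add: less_mult_imp_div_less)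
qed simp

lemma toeplitz_section_index:
  assumes "i < n" "a < N" "j < n" "b < N"
  shows "toeplitz_section N F n $$ (i * N + a, j * N + b)
    = (if j \<le> i then fps_nth (F $$ (a, b)) (i - j) else 0)"
  using assms by (simp add: toeplitz_section_def block_index_less)

lemma sum_over_blocks:
  fixes f :: "nat \<Rightarrow> 'a :: comm_monoid_add"
  shows "(\<Sum>r<n * N. f r) = (\<Sum>i<n. \<Sum>a<N. f (i * N + a))"
proof -
  have "(\<Sum>a<N. f (i * N + a)) = sum f {i * N..<i * N + N}" for i
    using sum.shift_bounds_nat_ivl[of f 0 "i * N" N] by (simp add: lessThan_atLeast0 add.commute)
  then show ?thesis by (simp add: sum.nat_group)
qed

text \<open>In a product of two lower triangular matrices, block \<open>(i, j)\<close> involves only the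
  intermediate block indices from \<open>j\<close> to \<open>i\<close>, which all lie below \<open>n\<close>. So truncation
  to order \<open>n\<close> cuts nothing off the Cauchy product.\<close>

lemma toeplitz_section_mult:
  assumes F: "F \<in> carrier_mat N N" and G: "G \<in> carrier_mat N N"
  shows "toeplitz_section N F n * toeplitz_section N G n = toeplitz_section N (F * G) n"
proof (rule eq_matI)
  fix r s assume "r < dim_row (toeplitz_section N (F * G) n)" "s < dim_col (toeplitz_section N (F * G) n)"
  then obtain i a j b where i: "i < n" "a < N" "r = i * N + a" and j: "j < n" "b < N" "s = j * N + b"
    by (auto elim!: block_index_cases)
  have "(toeplitz_section N F n * toeplitz_section N G n) $$ (r, s)
      = (\<Sum>q<n * N. toeplitz_section N F n $$ (r, q) * toeplitz_section N G n $$ (q, s))"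
    using i j by (simp add: scalar_prod_def block_index_less lessThan_atLeast0)
  also have "\<dots> = (\<Sum>k<n. \<Sum>c<N. if j \<le> k \<and> k \<le> i then
      fps_nth (F $$ (a, c)) (i - k) * fps_nth (G $$ (c, b)) (k - j) else 0)"
    unfolding sum_over_blocks using i j
    by (intro sum.cong refl) (auto simp: toeplitz_section_index)
  also have "\<dots> = (\<Sum>c<N. \<Sum>k<n. if j \<le> k \<and> k \<le> i then
      fps_nth (F $$ (a, c)) (i - k) * fps_nth (G $$ (c, b)) (k - j) else 0)"
    by (rule sum.swap)
  also have "\<dots> = (\<Sum>c<N. if j \<le> i then fps_nth (F $$ (a, c) * G $$ (c, b)) (i - j) else 0)"
  proof (rule sum.cong[OF refl])
    fix c
    let ?f = "fps_nth (F $$ (a, c))" and ?g = "fps_nth (G $$ (c, b))"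
    have "(\<Sum>k<n. if j \<le> k \<and> k \<le> i then ?f (i - k) * ?g (k - j) else 0)
        = (\<Sum>k\<in>{j..i}. ?f (i - k) * ?g (k - j))"
      using i by (intro sum.mono_neutral_cong_right) auto
    also have "\<dots> = (if j \<le> i then (\<Sum>l=0..i - j. ?f l * ?g (i - j - l)) else 0)"
      by (auto intro!: sum.reindex_bij_witness[of _ "\<lambda>l. i - l" "\<lambda>k. i - k"])
    finally show "(\<Sum>k<n. if j \<le> k \<and> k \<le> i then ?f (i - k) * ?g (k - j) else 0)
        = (if j \<le> i then fps_nth (F $$ (a, c) * G $$ (c, b)) (i - j) else 0)"
      by (simp add: fps_mult_nth)
  qed
  also have "\<dots> = toeplitz_section N (F * G) n $$ (r, s)"
    using i j F G by (simp add: toeplitz_section_index scalar_prod_def fps_sum_nth lessThan_atLeast0)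
  finally show "(toeplitz_section N F n * toeplitz_section N G n) $$ (r, s)
    = toeplitz_section N (F * G) n $$ (r, s)" .
qed simp_all

lemma toeplitz_section_one: "toeplitz_section N (1\<^sub>m N) n = 1\<^sub>m (n * N)"
proof (rule eq_matI)
  fix r s assume "r < dim_row (1\<^sub>m (n * N) :: complex mat)" "s < dim_col (1\<^sub>m (n * N) :: complex mat)"
  then obtain i a j b where i: "i < n" "a < N" "r = i * N + a" and j: "j < n" "b < N" "s = j * N + b"
    by (auto elim!: block_index_cases)
  have "r = s \<longleftrightarrow> i = j \<and> a = b"
    using i j by (metis add_diff_cancel_left' div_mult_self3 div_less gr_implies_not0 add_0_right)
  then show "toeplitz_section N (1\<^sub>m N) n $$ (r, s) = 1\<^sub>m (n * N) $$ (r, s)"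
    using i j by (auto simp: toeplitz_section_index block_index_less)
qed simp_all

lemma coeff_matrix_poly:
  assumes "a < N" "b < N"
  shows "coeff (matrix_poly N m M $$ (a, b)) k = (if k \<le> m then M k $$ (a, b) else 0)"
  using assms by (simp add: matrix_poly_def coeff_sum sum.delta)

lemma block_toeplitz_eq_toeplitz_section:
  "block_toeplitz N m M n = toeplitz_section N (map_mat fps_of_poly (matrix_poly N m M)) n"
proof (rule eq_matI)
  let ?T = "toeplitz_section N (map_mat fps_of_poly (matrix_poly N m M)) n"
  fix r s assume "r < dim_row ?T" "s < dim_col ?T"
  then obtain i a j b where i: "i < n" "a < N" "r = i * N + a" and j: "j < n" "b < N" "s = j * N + b"
    by (auto elim!: block_index_cases)
  moreover have "dim_row (matrix_poly N m M) = N" "dim_col (matrix_poly N m M) = N"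
    by (simp_all add: matrix_poly_def)
  ultimately show "block_toeplitz N m M n $$ (r, s) = ?T $$ (r, s)"
    by (auto simp: block_toeplitz_def block_index_less toeplitz_section_index coeff_matrix_poly
        coeff_block_def nat_diff_distrib)
qed (simp_all add: block_toeplitz_def)


section \<open>Zeros of the determinant in the closed unit disc\<close>

text \<open>The blocks are $z^{n-1} w, \ldots, z w, w$. Ordering the powers so that the last block is \<open>w\<close>
  (instead of using $z^{-j} w$) keeps the vector nonzero and meaningful for $z = 0$.\<close>

definition geometric_block_vec :: "nat \<Rightarrow> nat \<Rightarrow> complex \<Rightarrow> complex vec \<Rightarrow> complex vec" where
  "geometric_block_vec N n z w = vec (n * N) (\<lambda>r. z ^ (n - Suc (r div N)) * w $ (r mod N))"

lemma geometric_block_vec_carrier [simp]: "geometric_block_vec N n z w \<in> carrier_vec (n * N)"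
  by (simp add: geometric_block_vec_def)

lemma dim_geometric_block_vec [simp]: "dim_vec (geometric_block_vec N n z w) = n * N"
  by (simp add: geometric_block_vec_def)

lemma geometric_block_vec_index:
  assumes "i < n" "a < N"
  shows "geometric_block_vec N n z w $ (i * N + a) = z ^ (n - Suc i) * w $ a"
  using assms by (simp add: geometric_block_vec_def block_index_less)

lemma euclid_norm_geometric_block_vec:
  assumes w: "w \<in> carrier_vec N"
  shows "euclid_norm (geometric_block_vec N n z w) = L2_set (\<lambda>j. cmod z ^ j) {..<n} * euclid_norm w"
proof -
  let ?x = "geometric_block_vec N n z w"
  have "(\<Sum>r<n * N. (cmod (?x $ r))\<^sup>2) = (\<Sum>i<n. \<Sum>a<N. (cmod z ^ (n - Suc i))\<^sup>2 * (cmod (w $ a))\<^sup>2)"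
    unfolding sum_over_blocks
    by (intro sum.cong refl) (simp add: geometric_block_vec_index norm_mult norm_power power_mult_distrib)
  also have "\<dots> = (\<Sum>i<n. (cmod z ^ (n - Suc i))\<^sup>2) * (\<Sum>a<N. (cmod (w $ a))\<^sup>2)"
    by (simp add: sum_product)
  also have "(\<Sum>i<n. (cmod z ^ (n - Suc i))\<^sup>2) = (\<Sum>j<n. (cmod z ^ j)\<^sup>2)"
    by (rule sum.nat_diff_reindex)
  finally have "(\<Sum>r<n * N. (cmod (?x $ r))\<^sup>2)
    = (\<Sum>j<n. (cmod z ^ j)\<^sup>2) * (\<Sum>a<N. (cmod (w $ a))\<^sup>2)" .
  then show ?thesis
    using w by (simp add: euclid_norm_def L2_set_def real_sqrt_mult)
qed

text \<open>The Toeplitz structure evaluates a partial sum of the symbol at \<open>z\<close>: in row block \<open>i\<close> the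
  exponents split as $n - 1 - j = (n - 1 - i) + k$ with $k = i - j$.\<close>

lemma toeplitz_section_geometric:
  assumes i: "i < n" and a: "a < N"
  shows "(toeplitz_section N F n *\<^sub>v geometric_block_vec N n z w) $ (i * N + a)
    = z ^ (n - Suc i) * (\<Sum>k\<le>i. (\<Sum>b<N. fps_nth (F $$ (a, b)) k * w $ b) * z ^ k)"
proof -
  let ?x = "geometric_block_vec N n z w"
  let ?f = "\<lambda>k. \<Sum>b<N. fps_nth (F $$ (a, b)) k * w $ b"
  have "(toeplitz_section N F n *\<^sub>v ?x) $ (i * N + a)
      = (\<Sum>q<n * N. toeplitz_section N F n $$ (i * N + a, q) * ?x $ q)"
    using i a by (simp add: scalar_prod_def block_index_less lessThan_atLeast0 geometric_block_vec_def)
  also have "\<dots> = (\<Sum>j<n. if j \<le> i then ?f (i - j) * z ^ (n - Suc j) else 0)"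
    unfolding sum_over_blocks using i a
    by (intro sum.cong refl)
      (auto simp: toeplitz_section_index geometric_block_vec_index sum_distrib_right
        mult.assoc mult.commute[of "z ^ _"]
        intro!: sum.cong)
  also have "\<dots> = (\<Sum>j\<le>i. ?f (i - j) * z ^ (n - Suc j))"
    using i by (intro sum.mono_neutral_cong_right) auto
  also have "\<dots> = (\<Sum>k\<le>i. ?f k * z ^ (n - Suc (i - k)))"
    by (rule sum.reindex_bij_witness[of _ "\<lambda>k. i - k" "\<lambda>k. i - k"]) auto
  also have "\<dots> = (\<Sum>k\<le>i. z ^ (n - Suc i) * (?f k * z ^ k))"
  proof (rule sum.cong[OF refl])
    fix k assume "k \<in> {..i}"
    then have "n - Suc (i - k) = (n - Suc i) + k" using i by simp
    then show "?f k * z ^ (n - Suc (i - k)) = z ^ (n - Suc i) * (?f k * z ^ k)"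
      by (simp add: power_add)
  qed
  finally show ?thesis by (simp add: sum_distrib_left)
qed

lemma poly_det:
  fixes S :: "'a :: comm_ring_1 poly mat"
  shows "poly (det S) z = det (map_mat (\<lambda>p. poly p z) S)"
proof -
  interpret comm_ring_hom "\<lambda>p. poly p z" by unfold_locales auto
  show ?thesis by simp
qed

lemma kernel_vector_at_zero:
  fixes S :: "complex poly mat"
  assumes S: "S \<in> carrier_mat N N" and z: "poly (det S) z = 0"
  obtains w where "w \<in> carrier_vec N" "w \<noteq> 0\<^sub>v N"
    "\<And>a. a < N \<Longrightarrow> (\<Sum>b<N. poly (S $$ (a, b)) z * w $ b) = 0"
proof -
  let ?A = "map_mat (\<lambda>p. poly p z) S"
  have A: "?A \<in> carrier_mat N N" using S by simp
  obtain w where w: "w \<in> carrier_vec N" "w \<noteq> 0\<^sub>v N" "?A *\<^sub>v w = 0\<^sub>v N"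
    using det_0_iff_vec_prod_zero[OF A] z by (auto simp: poly_det)
  have "(\<Sum>b<N. poly (S $$ (a, b)) z * w $ b) = 0" if "a < N" for a
  proof -
    have "(\<Sum>b<N. poly (S $$ (a, b)) z * w $ b) = (?A *\<^sub>v w) $ a"
      using that S w(1) by (simp add: scalar_prod_def lessThan_atLeast0)
    then show ?thesis using w(3) that by simp
  qed
  with w that show ?thesis by blast
qed

text \<open>For $z = 0$ the geometric block vector is \<open>w\<close> in the last block and zero elsewhere, and the last
  block column of the Toeplitz matrix contains only the constant coefficient of the symbol.\<close>

lemma cond_number_toeplitz_section_infinite:
  assumes S: "S \<in> carrier_mat N N" and z: "poly (det S) 0 = 0" and n: "n \<ge> 1"
  shows "cond_number (toeplitz_section N (map_mat fps_of_poly S) n) = \<infinity>"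
proof -
  obtain w where w: "w \<in> carrier_vec N" "w \<noteq> 0\<^sub>v N"
    "\<And>a. a < N \<Longrightarrow> (\<Sum>b<N. poly (S $$ (a, b)) 0 * w $ b) = 0"
    using kernel_vector_at_zero[OF S z] by blast
  let ?T = "toeplitz_section N (map_mat fps_of_poly S) n"
  let ?x = "geometric_block_vec N n 0 w"
  show ?thesis
  proof (rule cond_number_singular[of ?T "n * N" ?x])
    have "L2_set (\<lambda>j. cmod 0 ^ j) {..<n} \<noteq> 0"
      using n by (auto simp: L2_set_eq_0_iff intro!: bexI[of _ 0])
    moreover have "euclid_norm w \<noteq> 0" using euclid_norm_eq_0 w by blast
    ultimately have "euclid_norm ?x \<noteq> 0" by (simp add: euclid_norm_geometric_block_vec[OF w(1)])
    then show "?x \<noteq> 0\<^sub>v (n * N)" by auto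
    show "?T *\<^sub>v ?x = 0\<^sub>v (n * N)"
    proof (rule eq_vecI)
      fix r assume "r < dim_vec (0\<^sub>v (n * N) :: complex vec)"
      then obtain i a where i: "i < n" "a < N" "r = i * N + a" by (auto elim!: block_index_cases)
      have "(\<Sum>k\<le>i. (\<Sum>b<N. coeff (S $$ (a, b)) k * w $ b) * 0 ^ k) = (\<Sum>b<N. coeff (S $$ (a, b)) 0 * w $ b)"
        by (simp add: power_0_left if_distrib[of "(*) _"] sum.delta cong: if_cong)
      also have "\<dots> = 0" using w(3)[OF i(2)] by (simp add: poly_0_coeff_0)
      finally show "(?T *\<^sub>v ?x) $ r = 0\<^sub>v (n * N) $ r"
        using i S by (simp add: toeplitz_section_geometric block_index_less del: index_mult_mat_vec)
    qed simp
  qed auto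
qed

text \<open>The test vector is the geometric block vector of a kernel vector of $S(z)$. Its image is
  supported in the first \<open>m\<close> blocks, where \<open>m\<close> bounds the degrees of \<open>S\<close>, and is of order $|z|^n$ there.\<close>

lemma cond_number_toeplitz_section_lower_bound:
  assumes S: "S \<in> carrier_mat N N" and N: "N \<ge> 1"
    and z: "poly (det S) z = 0" "z \<noteq> 0" "cmod z \<le> 1"
  obtains K where "K > 0"
    "\<And>n. n \<ge> 1 \<Longrightarrow> ereal (K * (L2_set (\<lambda>j. cmod z ^ j) {..<n} / cmod z ^ n))
       \<le> cond_number (toeplitz_section N (map_mat fps_of_poly S) n)"
proof (cases "poly (det S) 0 = 0")
  case True
  then show ?thesis using that[of 1] cond_number_toeplitz_section_infinite[OF S] by simp
next
  case False
  let ?T = "\<lambda>n. toeplitz_section N (map_mat fps_of_poly S) n"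
  obtain w where w: "w \<in> carrier_vec N" "w \<noteq> 0\<^sub>v N"
    "\<And>a. a < N \<Longrightarrow> (\<Sum>b<N. poly (S $$ (a, b)) z * w $ b) = 0"
    using kernel_vector_at_zero[OF S z(1)] by blast
  have w_pos: "euclid_norm w > 0"
    using euclid_norm_eq_0[OF _ w(1)] w(2) euclid_norm_nonneg[of w] by fastforce
  \<comment> \<open>The constant coefficient of \<open>S\<close> is invertible here, and any of its nonzero entries bounds
    the norms of all Toeplitz matrices from below.\<close>
  obtain a0 b0 where c: "a0 < N" "b0 < N" "coeff (S $$ (a0, b0)) 0 \<noteq> 0"
  proof -
    have "\<not> (\<forall>a<N. \<forall>b<N. coeff (S $$ (a, b)) 0 = 0)"
    proof
      assume "\<forall>a<N. \<forall>b<N. coeff (S $$ (a, b)) 0 = 0"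
      then have "map_mat (\<lambda>p. poly p 0) S = 0\<^sub>m N N"
        using S by (intro eq_matI) (auto simp: poly_0_coeff_0)
      then show False using False N by (simp add: poly_det)
    qed
    then show ?thesis using that by blast
  qed
  define c where "c = cmod (coeff (S $$ (a0, b0)) 0)"
  have c_le: "c \<le> spectral_norm (?T n)" if "n \<ge> 1" for n
  proof -
    have "c = cmod (?T n $$ (0 * N + a0, 0 * N + b0))"
      using c S that unfolding c_def by (subst toeplitz_section_index) auto
    also have "\<dots> \<le> spectral_norm (?T n)"
      using c that by (intro entry_le_spectral_norm) (simp_all add: block_index_less[of 0 n _ N, simplified])
    finally show ?thesis .
  qed
  define m where "m = (\<Sum>a<N. \<Sum>b<N. degree (S $$ (a, b)))"
  have deg: "degree (S $$ (a, b)) \<le> m" if "a < N" "b < N" for a b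
  proof -
    have "degree (S $$ (a, b)) \<le> (\<Sum>b<N. degree (S $$ (a, b)))"
      using that by (intro member_le_sum) auto
    also have "\<dots> \<le> m" unfolding m_def
      using that by (intro member_le_sum) auto
    finally show ?thesis .
  qed
  define p where "p i a = (\<Sum>k\<le>i. (\<Sum>b<N. coeff (S $$ (a, b)) k * w $ b) * z ^ k)" for i a
  have p_zero: "p i a = 0" if "a < N" "m \<le> i" for i a
  proof -
    have "p i a = (\<Sum>b<N. (\<Sum>k\<le>i. coeff (S $$ (a, b)) k * z ^ k) * w $ b)"
      unfolding p_def sum_distrib_right by (subst sum.swap) (simp add: mult_ac)
    also have "\<dots> = (\<Sum>b<N. poly (S $$ (a, b)) z * w $ b)"
    proof (intro sum.cong refl arg_cong2[of _ _ _ _ "(*)"])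
      fix b assume "b \<in> {..<N}"
      then have "degree (S $$ (a, b)) \<le> i" using deg[of a b] that by simp
      then show "(\<Sum>k\<le>i. coeff (S $$ (a, b)) k * z ^ k) = poly (S $$ (a, b)) z"
        unfolding poly_altdef by (intro sum.mono_neutral_right) (auto simp: coeff_eq_0)
    qed
    finally show ?thesis using w(3) that by simp
  qed
  \<comment> \<open>The summand 1 makes the bound positive, so that it can be divided by.\<close>
  define E where "E = 1 + (\<Sum>i<m. \<Sum>a<N. cmod (p i a))"
  have E: "E > 0" unfolding E_def by (intro add_pos_nonneg sum_nonneg) auto
  have Tx_le: "euclid_norm (?T n *\<^sub>v geometric_block_vec N n z w) \<le> E / cmod z ^ m * cmod z ^ n" for n
  proof -
    let ?y = "?T n *\<^sub>v geometric_block_vec N n z w"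
    have "euclid_norm ?y \<le> (\<Sum>i<n. \<Sum>a<N. cmod (?y $ (i * N + a)))"
      using euclid_norm_le_sum[of ?y] by (simp add: sum_over_blocks del: index_mult_mat_vec)
    also have "\<dots> \<le> (\<Sum>i<n. \<Sum>a<N. if i < m then cmod z ^ n / cmod z ^ m * cmod (p i a) else 0)"
    proof (intro sum_mono)
      fix i a assume i: "i \<in> {..<n}" and a: "a \<in> {..<N}"
      have y: "?y $ (i * N + a) = z ^ (n - Suc i) * p i a"
        unfolding p_def using i a S by (subst toeplitz_section_geometric) auto
      show "cmod (?y $ (i * N + a)) \<le> (if i < m then cmod z ^ n / cmod z ^ m * cmod (p i a) else 0)"
      proof (cases "i < m")
        case True
        have "cmod z ^ (n - Suc i) * cmod z ^ m \<le> cmod z ^ n"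
          using True i z by (subst power_add[symmetric], intro power_decreasing) auto
        then have "cmod z ^ (n - Suc i) \<le> cmod z ^ n / cmod z ^ m"
          using z by (simp add: field_simps)
        from mult_right_mono[OF this norm_ge_zero[of "p i a"]] show ?thesis
          using True y by (simp add: norm_mult norm_power)
      qed (use y p_zero a in simp)
    qed
    also have "\<dots> = (\<Sum>i<n. if i < m then cmod z ^ n / cmod z ^ m * (\<Sum>a<N. cmod (p i a)) else 0)"
      by (intro sum.cong refl) (simp add: sum_distrib_left)
    also have "\<dots> \<le> (\<Sum>i<m. cmod z ^ n / cmod z ^ m * (\<Sum>a<N. cmod (p i a)))"
      by (subst sum.inter_filter[symmetric], simp, intro sum_mono2)
        (auto intro!: divide_nonneg_nonneg mult_nonneg_nonneg sum_nonneg)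
    also have "\<dots> \<le> cmod z ^ n / cmod z ^ m * E"
      unfolding E_def sum_distrib_left[symmetric] by (intro mult_left_mono) auto
    finally show ?thesis by (simp add: mult_ac)
  qed
  show ?thesis
  proof (rule that)
    show "c * euclid_norm w * cmod z ^ m / E > 0"
      using c w_pos E z by (simp add: c_def)
    fix n :: nat assume n: "n \<ge> 1"
    have "0 < L2_set (\<lambda>j. cmod z ^ j) {..<n}"
      using member_le_L2_set[of "{..<n}" 0 "\<lambda>j. cmod z ^ j"] n by simp
    then have x: "geometric_block_vec N n z w \<noteq> 0\<^sub>v (n * N)"
      using w_pos euclid_norm_geometric_block_vec[OF w(1), of n z] by auto
    have "ereal (c * euclid_norm (geometric_block_vec N n z w) / (E / cmod z ^ m * cmod z ^ n))
        \<le> cond_number (?T n)"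
      by (rule cond_number_lower_bound[of _ "n * N"])
        (use x c_le n E z Tx_le in \<open>auto simp: c_def\<close>)
    then show "ereal (c * euclid_norm w * cmod z ^ m / E * (L2_set (\<lambda>j. cmod z ^ j) {..<n} / cmod z ^ n))
        \<le> cond_number (?T n)"
      by (simp add: euclid_norm_geometric_block_vec[OF w(1)] mult_ac)
  qed
qed

section \<open>Power series with polynomially bounded coefficients\<close>

definition poly_growth :: "complex fps \<Rightarrow> bool" where
  "poly_growth f \<longleftrightarrow> (\<exists>C d. \<forall>k. cmod (fps_nth f k) \<le> C * real (k + 1) ^ d)"

lemma poly_growthE:
  assumes "poly_growth f"
  obtains C d where "C \<ge> 0" "\<And>k. cmod (fps_nth f k) \<le> C * real (k + 1) ^ d"
proof -
  obtain C d where C: "\<And>k. cmod (fps_nth f k) \<le> C * real (k + 1) ^ d"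
    using assms unfolding poly_growth_def by blast
  from order_trans[OF norm_ge_zero C[of 0]] have "C \<ge> 0" by simp
  with C that show ?thesis by blast
qed

text \<open>The Cauchy product has \<open>k + 1\<close> summands, which costs one more power.\<close>

lemma poly_growth_mult:
  assumes "poly_growth f" "poly_growth g" shows "poly_growth (f * g)"
proof -
  obtain C d where C: "C \<ge> 0" "\<And>k. cmod (fps_nth f k) \<le> C * real (k + 1) ^ d"
    using poly_growthE[OF assms(1)] by blast
  obtain C' d' where C': "C' \<ge> 0" "\<And>k. cmod (fps_nth g k) \<le> C' * real (k + 1) ^ d'"
    using poly_growthE[OF assms(2)] by blast
  have "cmod (fps_nth (f * g) k) \<le> (C * C') * real (k + 1) ^ (d + d' + 1)" for k
  proof -
    have "cmod (fps_nth (f * g) k) \<le> (\<Sum>i=0..k. (C * real (k + 1) ^ d) * (C' * real (k + 1) ^ d'))"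
      unfolding fps_mult_nth
    proof (intro sum_norm_le)
      fix i assume "i \<in> {0..k}"
      then have "C * real (i + 1) ^ d \<le> C * real (k + 1) ^ d"
        "C' * real (k - i + 1) ^ d' \<le> C' * real (k + 1) ^ d'"
        using C C' by (auto intro!: mult_left_mono power_mono)
      with C(2)[of i] C'(2)[of "k - i"] have
        "cmod (fps_nth f i) \<le> C * real (k + 1) ^ d" "cmod (fps_nth g (k - i)) \<le> C' * real (k + 1) ^ d'"
        by linarith+
      then show "cmod (fps_nth f i * fps_nth g (k - i)) \<le> (C * real (k + 1) ^ d) * (C' * real (k + 1) ^ d')"
        unfolding norm_mult using C by (intro mult_mono) auto
    qed
    then show ?thesis by (simp add: power_add mult_ac)
  qed
  then show ?thesis unfolding poly_growth_def by blast
qed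

lemma poly_growth_fps_of_poly: "poly_growth (fps_of_poly p)"
proof -
  have "cmod (coeff p k) \<le> (\<Sum>i\<le>degree p. cmod (coeff p i)) * real (k + 1) ^ 0" for k
  proof (cases "k \<le> degree p")
    case True
    then show ?thesis using member_le_sum[of k "{..degree p}" "\<lambda>i. cmod (coeff p i)"] by simp
  next
    case False
    then show ?thesis by (auto simp: coeff_eq_0 intro!: sum_nonneg)
  qed
  then show ?thesis unfolding poly_growth_def fps_of_poly_nth by blast
qed

text \<open>The inverse is the geometric series $-\sum_k z^{-k-1} t^k$.\<close>

lemma poly_growth_inverse_linear:
  assumes "cmod z \<ge> 1" shows "poly_growth (inverse (fps_of_poly [:-z, 1:]))"
proof -
  have z: "z \<noteq> 0" using assms by auto
  define g where "g = Abs_fps (\<lambda>k. - (inverse z ^ Suc k))"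
  have "fps_of_poly [:-z, 1:] * g = 1"
  proof (rule fps_ext)
    fix k show "fps_nth (fps_of_poly [:-z, 1:] * g) k = fps_nth 1 k"
      using z by (cases k) (auto simp: fps_of_poly_linear g_def distrib_right)
  qed
  then have "inverse (fps_of_poly [:-z, 1:]) = g" by (rule fps_inverse_unique)
  moreover have "cmod (fps_nth g k) \<le> 1 * real (k + 1) ^ 0" for k
  proof -
    have "cmod (fps_nth g k) = inverse (cmod z) ^ Suc k"
      by (simp add: g_def norm_mult norm_power norm_inverse)
    also have "\<dots> \<le> 1" using assms by (intro power_le_one) (auto simp: inverse_eq_divide divide_le_eq_1)
    finally show ?thesis by simp
  qed
  ultimately show ?thesis unfolding poly_growth_def by metis
qed

lemma poly_growth_inverse_fps_of_poly:
  assumes "p \<noteq> 0" "\<And>z. poly p z = 0 \<Longrightarrow> cmod z \<ge> 1"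
  shows "poly_growth (inverse (fps_of_poly p))"
  using assms
proof (induction "degree p" arbitrary: p)
  case 0
  then obtain c where p: "p = [:c:]" by (metis degree_eq_zeroE)
  have "inverse (fps_of_poly p) = fps_of_poly [:inverse c:]"
    by (simp add: p fps_of_poly_const fps_const_inverse)
  then show ?case using poly_growth_fps_of_poly by simp
next
  case (Suc d)
  have "\<not> constant (poly p)" using Suc.hyps by (simp add: constant_degree)
  then obtain z where z: "poly p z = 0" using fundamental_theorem_of_algebra by blast
  then obtain q where p: "p = [:-z, 1:] * q" by (auto simp: poly_eq_0_iff_dvd)
  have q: "q \<noteq> 0" using p Suc.prems by auto
  have "degree p = Suc (degree q)" unfolding p using q by (subst degree_mult_eq) auto
  then have "poly_growth (inverse (fps_of_poly q))"
    using Suc.hyps Suc.prems q by (intro Suc.hyps(1)) (auto simp: p)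
  moreover have "poly_growth (inverse (fps_of_poly [:-z, 1:]))"
    by (rule poly_growth_inverse_linear) (use Suc.prems z in blast)
  ultimately show ?case
    unfolding p fps_of_poly_mult fps_inverse_mult by (rule poly_growth_mult[rotated])
qed

text \<open>Finitely many polynomial bounds have a common one: the constants and the exponents can be
  added because both are nonnegative and \<open>k + 1 \<ge> 1\<close>.\<close>

lemma uniform_poly_growth:
  assumes "finite A" "\<And>x. x \<in> A \<Longrightarrow> poly_growth (f x)"
  obtains C d where "C \<ge> 0" "\<And>x k. x \<in> A \<Longrightarrow> cmod (fps_nth (f x) k) \<le> C * real (k + 1) ^ d"
proof -
  have "\<forall>x\<in>A. \<exists>C d. C \<ge> 0 \<and> (\<forall>k. cmod (fps_nth (f x) k) \<le> C * real (k + 1) ^ d)"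
    using assms(2) poly_growthE by metis
  then obtain C d where C: "\<And>x. x \<in> A \<Longrightarrow> C x \<ge> 0"
    "\<And>x k. x \<in> A \<Longrightarrow> cmod (fps_nth (f x) k) \<le> C x * real (k + 1) ^ d x"
    by metis
  show ?thesis
  proof (rule that)
    show "(\<Sum>x\<in>A. C x) \<ge> 0" using C by (intro sum_nonneg)
    fix x k assume x: "x \<in> A"
    have "C x \<le> (\<Sum>x\<in>A. C x)" "d x \<le> (\<Sum>x\<in>A. d x)"
      using x C assms(1) by (auto intro!: member_le_sum)
    then have "C x * real (k + 1) ^ d x \<le> (\<Sum>x\<in>A. C x) * real (k + 1) ^ (\<Sum>x\<in>A. d x)"
      using C x by (intro mult_mono power_increasing sum_nonneg) auto
    with C(2)[OF x, of k] show "cmod (fps_nth (f x) k) \<le> (\<Sum>x\<in>A. C x) * real (k + 1) ^ (\<Sum>x\<in>A. d x)"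
      by linarith
  qed
qed

section \<open>Determinants without zeros in the open unit disc\<close>

lemma entry_sum_toeplitz_section_le:
  assumes "\<And>a b. a < N \<Longrightarrow> b < N \<Longrightarrow> poly_growth (F $$ (a, b))"
  obtains C d where "C \<ge> 0" "\<And>n. entry_sum (toeplitz_section N F n) \<le> C * real n ^ d"
proof -
  obtain C d where C: "C \<ge> 0" "\<And>x k. x \<in> {..<N} \<times> {..<N} \<Longrightarrow> cmod (fps_nth (F $$ x) k) \<le> C * real (k + 1) ^ d"
    by (rule uniform_poly_growth[of "{..<N} \<times> {..<N}" "\<lambda>x. F $$ x"]) (use assms in auto)
  have "entry_sum (toeplitz_section N F n) \<le> (real N * real N * C) * real n ^ (d + 2)" for n
  proof -
    let ?T = "toeplitz_section N F n"
    have "cmod (?T $$ (r, s)) \<le> C * real n ^ d" if r: "r < n * N" and s: "s < n * N" for r s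
    proof -
      obtain i a j b where i: "i < n" "a < N" "r = i * N + a" and j: "j < n" "b < N" "s = j * N + b"
        using r s by (auto elim!: block_index_cases)
      show ?thesis
      proof (cases "j \<le> i")
        case True
        have "cmod (?T $$ (r, s)) \<le> C * real (i - j + 1) ^ d"
          using True i j C(2)[of "(a, b)" "i - j"] by (simp add: toeplitz_section_index)
        also have "\<dots> \<le> C * real n ^ d"
          using i C by (intro mult_left_mono power_mono) auto
        finally show ?thesis .
      qed (use i j C in \<open>simp add: toeplitz_section_index\<close>)
    qed
    then have "entry_sum ?T \<le> (\<Sum>r<n * N. \<Sum>s<n * N. C * real n ^ d)"
      unfolding entry_sum_def dim_toeplitz_section by (intro sum_mono) auto
    also have "\<dots> = (real N * real N * C) * real n ^ (d + 2)"
      by (simp add: power_add power2_eq_square mult_ac)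
    finally show ?thesis .
  qed
  then show ?thesis using C by (intro that[of "real N * real N * C" "d + 2"]) auto
qed

text \<open>Cramer's rule over the ring of power series, in which $\det S$ is a unit because its
  constant coefficient does not vanish.\<close>

lemma fps_matrix_inverse:
  fixes S :: "complex poly mat"
  assumes S: "S \<in> carrier_mat N N" and nz: "poly (det S) 0 \<noteq> 0"
  defines "F \<equiv> map_mat fps_of_poly S"
    and "G \<equiv> inverse (fps_of_poly (det S)) \<cdot>\<^sub>m map_mat fps_of_poly (adj_mat S)"
  shows "F * G = 1\<^sub>m N" "G * F = 1\<^sub>m N"
proof -
  interpret h: comm_ring_hom "fps_of_poly :: complex poly \<Rightarrow> complex fps"
    by unfold_locales (auto simp: fps_of_poly_add fps_of_poly_mult)
  let ?H = "map_mat fps_of_poly (adj_mat S)" and ?d = "fps_of_poly (det S)"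
  note adj = adj_mat[OF S]
  have F: "F \<in> carrier_mat N N" and H: "?H \<in> carrier_mat N N"
    using S adj(1) by (auto simp: F_def)
  have FH: "F * ?H = ?d \<cdot>\<^sub>m 1\<^sub>m N"
    unfolding F_def h.mat_hom_mult[OF S adj(1), symmetric] adj(2)
    by (intro eq_matI) auto
  have HF: "?H * F = ?d \<cdot>\<^sub>m 1\<^sub>m N"
    unfolding F_def h.mat_hom_mult[OF adj(1) S, symmetric] adj(3)
    by (intro eq_matI) auto
  have "inverse ?d * ?d = 1" using nz by (intro inverse_mult_eq_1) (simp add: poly_0_coeff_0)
  then have one: "inverse ?d \<cdot>\<^sub>m (?d \<cdot>\<^sub>m 1\<^sub>m N) = 1\<^sub>m N" by (intro eq_matI) auto
  show "F * G = 1\<^sub>m N"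
    unfolding G_def using mult_smult_distrib[OF F H] by (simp add: FH one)
  show "G * F = 1\<^sub>m N"
    unfolding G_def using mult_smult_assoc_mat[OF H F] by (simp add: HF one)
qed

text \<open>The inverse is the Toeplitz section of the power series matrix $S^{-1}$, whose entries have
  polynomially bounded coefficients.\<close>

lemma cond_number_toeplitz_section_poly_bound:
  assumes S: "S \<in> carrier_mat N N" and nz: "det S \<noteq> 0"
    and zeros: "\<And>z. poly (det S) z = 0 \<Longrightarrow> cmod z \<ge> 1"
  obtains C d where "\<And>n. cond_number (toeplitz_section N (map_mat fps_of_poly S) n) \<le> ereal (C * real n ^ d)"
proof -
  define F where "F = map_mat fps_of_poly S"
  define G where "G = inverse (fps_of_poly (det S)) \<cdot>\<^sub>m map_mat fps_of_poly (adj_mat S)"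
  have F: "F \<in> carrier_mat N N" and G: "G \<in> carrier_mat N N"
    using S adj_mat(1)[OF S] by (auto simp: F_def G_def)
  have "poly (det S) 0 \<noteq> 0" using zeros[of 0] by auto
  note FG = fps_matrix_inverse[OF S this, folded F_def G_def]
  have gF: "poly_growth (F $$ (a, b))" if "a < N" "b < N" for a b
    using that S by (simp add: F_def poly_growth_fps_of_poly)
  have gG: "poly_growth (G $$ (a, b))" if "a < N" "b < N" for a b
    using that adj_mat(1)[OF S]
    by (simp add: G_def poly_growth_fps_of_poly poly_growth_mult poly_growth_inverse_fps_of_poly nz zeros)
  obtain C d where C: "C \<ge> 0" "\<And>n. entry_sum (toeplitz_section N F n) \<le> C * real n ^ d"
    using entry_sum_toeplitz_section_le[of N F] gF by blast
  obtain C' d' where C': "C' \<ge> 0" "\<And>n. entry_sum (toeplitz_section N G n) \<le> C' * real n ^ d'"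
    using entry_sum_toeplitz_section_le[of N G] gG by blast
  have "cond_number (toeplitz_section N F n) \<le> ereal (C * C' * real n ^ (d + d'))" for n
  proof -
    have "cond_number (toeplitz_section N F n)
        \<le> ereal (entry_sum (toeplitz_section N F n) * entry_sum (toeplitz_section N G n))"
      by (rule cond_number_le[of _ "n * N"])
        (simp_all add: toeplitz_section_mult[OF F G] toeplitz_section_mult[OF G F] FG toeplitz_section_one)
    also have "\<dots> \<le> ereal ((C * real n ^ d) * (C' * real n ^ d'))"
      unfolding ereal_less_eq using C by (intro mult_mono C(2) C'(2) entry_sum_nonneg) auto
    finally show ?thesis by (simp add: power_add mult_ac)
  qed
  then show ?thesis using that unfolding F_def by blast
qed

section \<open>Growth of the condition numbers\<close>

lemma zero_of_type:
  assumes "of_type S s u l"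
  shows "s \<ge> 1 \<Longrightarrow> \<exists>z. poly (det S) z = 0 \<and> cmod z < 1"
    and "u \<ge> 1 \<Longrightarrow> \<exists>z. poly (det S) z = 0 \<and> cmod z = 1"
    and "s = 0 \<Longrightarrow> poly (det S) z = 0 \<Longrightarrow> cmod z \<ge> 1"
proof -
  have nz: "det S \<noteq> 0"
    and s: "size {#z \<in># proots (det S). cmod z < 1#} = s"
    and u: "size {#z \<in># proots (det S). cmod z = 1#} = u"
    using assms by (auto simp: of_type_def)
  show "\<exists>z. poly (det S) z = 0 \<and> cmod z < 1" if "s \<ge> 1"
  proof -
    have "{#z \<in># proots (det S). cmod z < 1#} \<noteq> {#}"
      using s that by (metis size_empty not_one_le_zero)
    then show ?thesis using nz by auto
  qed
  show "\<exists>z. poly (det S) z = 0 \<and> cmod z = 1" if "u \<ge> 1"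
  proof -
    have "{#z \<in># proots (det S). cmod z = 1#} \<noteq> {#}"
      using u that by (metis size_empty not_one_le_zero)
    then show ?thesis using nz by auto
  qed
  show "cmod z \<ge> 1" if "s = 0" "poly (det S) z = 0"
    using s that nz by (auto simp: not_less)
qed

theorem theorem4p2:
  fixes N m :: nat and M :: "nat \<Rightarrow> complex mat"
  assumes "N \<ge> 1"
    and "\<And>j. j \<le> m \<Longrightarrow> M j \<in> carrier_mat N N"
  shows "(\<forall>s u l. of_type (matrix_poly N m M) s u l \<and> u \<ge> 1 \<longrightarrow>
            limsup (\<lambda>n. cond_number (block_toeplitz N m M n)) = \<infinity>) \<and>
         (\<forall>u l. of_type (matrix_poly N m M) 0 u l \<longrightarrow>
            polynomially_bounded (\<lambda>n. cond_number (block_toeplitz N m M n))) \<and>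
         (\<forall>s l. of_type (matrix_poly N m M) s 0 l \<and> s \<ge> 1 \<longrightarrow>
            increases_exponentially (\<lambda>n. cond_number (block_toeplitz N m M n)))"
proof -
  let ?S = "matrix_poly N m M"
  let ?\<kappa> = "\<lambda>n. cond_number (block_toeplitz N m M n)"
  have S: "?S \<in> carrier_mat N N" by (simp add: matrix_poly_def)
  note T = block_toeplitz_eq_toeplitz_section
  have "limsup ?\<kappa> = \<infinity>" if type: "of_type ?S s u l" and u: "u \<ge> 1" for s u l
  proof -
    obtain z where z: "poly (det ?S) z = 0" "cmod z = 1" using zero_of_type(2)[OF type u] by blast
    have z': "z \<noteq> 0" "cmod z \<le> 1" using z by auto
    obtain K where K: "K > 0"
      "\<And>n. n \<ge> 1 \<Longrightarrow> ereal (K * (L2_set (\<lambda>j. cmod z ^ j) {..<n} / cmod z ^ n)) \<le> ?\<kappa> n"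
      unfolding T
      by (rule cond_number_toeplitz_section_lower_bound[OF S assms(1) z(1) z']) blast
    have K': "ereal (K * sqrt (real n)) \<le> ?\<kappa> n" if "n \<ge> 1" for n
      using K(2)[OF that] z(2) by (simp add: L2_set_constant)
    have "filterlim (\<lambda>n. K * sqrt (real n)) at_top sequentially"
      by (intro filterlim_tendsto_pos_mult_at_top[OF tendsto_const K(1)]
          filterlim_compose[OF sqrt_at_top filterlim_real_sequentially])
    then have "(\<lambda>n. ereal (K * sqrt (real n))) \<longlonglongrightarrow> \<infinity>" by (simp add: tendsto_PInfty_eq_at_top)
    then have "limsup (\<lambda>n. ereal (K * sqrt (real n))) = \<infinity>" by (intro lim_imp_Limsup) auto
    moreover have "limsup (\<lambda>n. ereal (K * sqrt (real n))) \<le> limsup ?\<kappa>"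
      by (intro Limsup_mono eventually_sequentiallyI[of 1] K')
    ultimately show ?thesis by simp
  qed
  moreover have "polynomially_bounded ?\<kappa>" if type: "of_type ?S 0 u l" for u l
  proof -
    have nz: "det ?S \<noteq> 0" using type by (simp add: of_type_def)
    obtain C d where C: "\<And>n. ?\<kappa> n \<le> ereal (C * real n ^ d)"
      using cond_number_toeplitz_section_poly_bound[OF S nz] zero_of_type(3)[OF type]
      unfolding T by blast
    have "\<forall>\<^sub>F n in sequentially. ?\<kappa> n \<le> ereal (C * real n powr real d)"
      using C by (intro eventually_sequentiallyI[of 1]) (simp add: powr_realpow)
    then show ?thesis unfolding polynomially_bounded_def by blast
  qed
  moreover have "increases_exponentially ?\<kappa>" if type: "of_type ?S s 0 l" and s: "s \<ge> 1" for s l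
  proof -
    obtain z where z: "poly (det ?S) z = 0" "cmod z < 1" using zero_of_type(1)[OF type s] by blast
    show ?thesis
    proof (cases "z = 0")
      case True
      then have "?\<kappa> n = \<infinity>" if "n \<ge> 1" for n
        using cond_number_toeplitz_section_infinite[OF S] z that unfolding T by blast
      then show ?thesis unfolding increases_exponentially_def by (auto intro!: exI[of _ 1])
    next
      case False
      obtain K where K: "K > 0"
        "\<And>n. n \<ge> 1 \<Longrightarrow> ereal (K * (L2_set (\<lambda>j. cmod z ^ j) {..<n} / cmod z ^ n)) \<le> ?\<kappa> n"
        unfolding T
        by (rule cond_number_toeplitz_section_lower_bound
            [OF S assms(1) z(1) False less_imp_le[OF z(2)]]) blast
      define \<gamma> where "\<gamma> = - ln (cmod z)"
      have \<gamma>: "\<gamma> > 0" using z False by (simp add: \<gamma>_def)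
      have "ereal (K * exp (\<gamma> * real n)) \<le> ?\<kappa> n" if n: "n \<ge> 1" for n
      proof -
        have "exp (\<gamma> * real n) = 1 / cmod z ^ n"
          using False by (simp add: \<gamma>_def exp_minus exp_of_nat2_mult inverse_eq_divide power_one_over)
        moreover have "1 \<le> L2_set (\<lambda>j. cmod z ^ j) {..<n}"
          using member_le_L2_set[of "{..<n}" 0 "\<lambda>j. cmod z ^ j"] n by simp
        ultimately have "K * exp (\<gamma> * real n) \<le> K * (L2_set (\<lambda>j. cmod z ^ j) {..<n} / cmod z ^ n)"
          using K(1) by (auto intro!: mult_left_mono divide_right_mono)
        then show ?thesis using K(2)[OF n] by (meson ereal_less_eq(3) order_trans)
      qed
      with K(1) \<gamma> show ?thesis unfolding increases_exponentially_def by blast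
    qed
  qed
  ultimately show ?thesis by blast
qed

end
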